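(* Let $r\ge 3$ be an integer and $\mathcal{A}_r=\{0,1,2^r-1,2^r+1\}$. Then $\phi_{\mathcal{A}_r}(x)=1+x+x^{2^r-1}+x^{2^r+1}$, and the sequence $\left(f_{\mathcal{A}_r}(n)\right)_{n\ge 0}$ modulo $2$ is periodic with least period dividing $4^r-1$. Among any $4^r-1$ consecutive terms of $\left(f_{\mathcal{A}_r}(n)\right)_{n\ge0}$, exactly $4^r-3^r$ terms are odd and $3^r-1$ terms are even.
   Context: For a finite set $\mathcal{A}$ of non-negative integers containing $0$, $f_{\mathcal{A}}(n)$ denotes the number of ways to write the non-negative integer $n$ in the form $n=\sum_{i=0}^{\infty}\epsilon_i2^i$ with every $\epsilon_i\in\mathcal{A}$ (so all but finitely many $\epsilon_i$ are $0$), and $\phi_{\mathcal{A}}(x)=\sum_{a\in\mathcal{A}}x^a\in\mathbb{F}_2[x]$. *)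

theory Defs
  imports "HOL-Library.Z2" "HOL-Computational_Algebra.Polynomial"
begin

text \<open>Representations \<open>n = (\<Sum>i. \<epsilon> i * 2 ^ i)\<close> with all digits in \<open>A\<close>; since all but
  finitely many digits vanish, the sum is taken over the finite support of \<open>\<epsilon>\<close>.\<close>

definition binary_reps :: "nat set \<Rightarrow> nat \<Rightarrow> (nat \<Rightarrow> nat) set" where
  "binary_reps A n =
     {\<epsilon>. (\<forall>i. \<epsilon> i \<in> A) \<and> finite {i. \<epsilon> i \<noteq> 0} \<and> (\<Sum>i | \<epsilon> i \<noteq> 0. \<epsilon> i * 2 ^ i) = n}"

definition num_reps :: "nat set \<Rightarrow> nat \<Rightarrow> nat" where
  "num_reps A n = card (binary_reps A n)"

text \<open>The set counted by \<open>num_reps\<close> is finite, so \<open>card\<close> never takes its default value on it.\<close>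

lemma finite_binary_reps: "finite (binary_reps A n)"
proof (rule finite_subset)
  let ?F = "{\<epsilon>. \<forall>i. (i \<in> {..n} \<longrightarrow> \<epsilon> i \<in> {..n}) \<and> (i \<notin> {..n} \<longrightarrow> \<epsilon> i = (0::nat))}"
  show "finite ?F"
    by (rule finite_set_of_finite_funs) auto
  show "binary_reps A n \<subseteq> ?F"
  proof
    fix \<epsilon> assume "\<epsilon> \<in> binary_reps A n"
    then have fin: "finite {i. \<epsilon> i \<noteq> 0}" and eq: "(\<Sum>i | \<epsilon> i \<noteq> 0. \<epsilon> i * 2 ^ i) = n"
      by (auto simp: binary_reps_def)
    have le: "\<epsilon> i * 2 ^ i \<le> n" if "\<epsilon> i \<noteq> 0" for i
      using member_le_sum[of i "{i. \<epsilon> i \<noteq> 0}" "\<lambda>i. \<epsilon> i * 2 ^ i"] that fin eq by auto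
    have bound: "\<epsilon> i \<le> n \<and> i \<le> n" if "\<epsilon> i \<noteq> 0" for i
    proof
      have "\<epsilon> i * 1 \<le> \<epsilon> i * 2 ^ i" by (rule mult_le_mono2) simp
      then show "\<epsilon> i \<le> n" using le[OF that] by linarith
      have "1 * 2 ^ i \<le> \<epsilon> i * 2 ^ i" using that by (intro mult_le_mono1) simp
      then have "2 ^ i \<le> n" using le[OF that] by linarith
      then show "i \<le> n" using less_exp[of i] by linarith
    qed
    have "\<epsilon> i \<le> n" for i using bound[of i] by (cases "\<epsilon> i = 0") auto
    moreover have "\<epsilon> i = 0" if "\<not> i \<le> n" for i using bound[of i] that by auto
    ultimately show "\<epsilon> \<in> ?F" by simp
  qed
qed

definition digit_poly :: "nat set \<Rightarrow> bit poly" where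
  "digit_poly A = (\<Sum>a\<in>A. monom 1 a)"

definition digit_set :: "nat \<Rightarrow> nat set" where
  "digit_set r = {0, 1, 2 ^ r - 1, 2 ^ r + 1}"

definition is_period :: "(nat \<Rightarrow> 'a) \<Rightarrow> nat \<Rightarrow> bool" where
  "is_period s p \<longleftrightarrow> p > 0 \<and> (\<forall>n. s (n + p) = s n)"

definition periodic :: "(nat \<Rightarrow> 'a) \<Rightarrow> bool" where
  "periodic s \<longleftrightarrow> (\<exists>p. is_period s p)"

text \<open>Only meaningful for periodic sequences.\<close>

definition least_period :: "(nat \<Rightarrow> 'a) \<Rightarrow> nat" where
  "least_period s = (LEAST p. is_period s p)"

end

theory Submission
  imports Defs "HOL-Computational_Algebra.Formal_Power_Series"
begin

text \<open>Splitting off the lowest digit and squaring in characteristic 2 show that the generating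
  series \<open>F\<close> of the sequence mod 2 satisfies \<open>F = \<phi> F(x\<^sup>2) = \<phi> F\<^sup>2\<close>, so \<open>F = 1 / \<phi>\<close>.
  With \<open>q = 2 ^ r\<close>, \<open>n = q - 1\<close> and \<open>N = 4 ^ r - 1\<close> one has \<open>\<phi> = (1 + x) u\<close>, where
  \<open>u = 1 + x ^ n + x ^ q\<close>, and the indicator series of the even terms is
  \<open>1 / (1 + x) + 1 / \<phi> = x ^ n / u\<close>. Writing \<open>y = x ^ q\<close>, one has \<open>u V = 1 + x ^ N\<close> for
  \<open>V = (\<Sum>b<n. y ^ b) + (\<Sum>a<n. x ^ (a + 1) y ^ (n - 1 - a) (1 + y) ^ a)\<close>, which makes the
  sequence \<open>N\<close>-periodic. All exponents occurring in \<open>V\<close> are distinct, and they are counted by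
  the odd entries of Pascal's triangle: the first \<open>2 ^ r\<close> rows contain \<open>3 ^ r\<close> of them.\<close>

unbundle fps_syntax

section \<open>Splitting off the lowest digit of a representation\<close>

lemma sum_binary_digits_shift:
  fixes \<epsilon> :: "nat \<Rightarrow> nat"
  assumes "finite {i. \<epsilon> i \<noteq> 0}"
  shows "(\<Sum>i | \<epsilon> i \<noteq> 0. \<epsilon> i * 2 ^ i) = \<epsilon> 0 + 2 * (\<Sum>i | \<epsilon> (Suc i) \<noteq> 0. \<epsilon> (Suc i) * 2 ^ i)"
proof -
  let ?S = "{i. \<epsilon> (Suc i) \<noteq> 0}"
  have S: "finite ?S"
    using finite_vimageI[OF assms, of Suc] by (simp add: vimage_def)
  have "(\<Sum>i | \<epsilon> i \<noteq> 0. \<epsilon> i * 2 ^ i) = (\<Sum>i\<in>insert 0 (Suc ` ?S). \<epsilon> i * 2 ^ i)"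
  proof (rule sum.mono_neutral_left)
    show "{i. \<epsilon> i \<noteq> 0} \<subseteq> insert 0 (Suc ` ?S)"
    proof
      fix i assume "i \<in> {i. \<epsilon> i \<noteq> 0}"
      then show "i \<in> insert 0 (Suc ` ?S)" by (cases i) auto
    qed
  qed (use S in auto)
  also have "\<dots> = \<epsilon> 0 + (\<Sum>i\<in>Suc ` ?S. \<epsilon> i * 2 ^ i)"
    using S by (subst sum.insert) auto
  also have "(\<Sum>i\<in>Suc ` ?S. \<epsilon> i * 2 ^ i) = 2 * (\<Sum>i\<in>?S. \<epsilon> (Suc i) * 2 ^ i)"
    by (subst sum.reindex) (auto simp: sum_distrib_left algebra_simps)
  finally show ?thesis .
qed

lemma finite_support_case_nat_iff:
  "finite {i. case_nat a \<delta> i \<noteq> (0::nat)} \<longleftrightarrow> finite {i. \<delta> i \<noteq> 0}"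
proof
  assume "finite {i. case_nat a \<delta> i \<noteq> 0}"
  from finite_vimageI[OF this, of Suc] show "finite {i. \<delta> i \<noteq> 0}"
    by (simp add: vimage_def)
next
  assume "finite {i. \<delta> i \<noteq> 0}"
  moreover have "{i. case_nat a \<delta> i \<noteq> 0} \<subseteq> insert 0 (Suc ` {i. \<delta> i \<noteq> 0})"
  proof
    fix i assume "i \<in> {i. case_nat a \<delta> i \<noteq> 0}"
    then show "i \<in> insert 0 (Suc ` {i. \<delta> i \<noteq> 0})" by (cases i) auto
  qed
  ultimately show "finite {i. case_nat a \<delta> i \<noteq> 0}"
    by (meson finite_imageI finite_insert finite_subset)
qed

text \<open>\<open>case_nat a \<delta>\<close> prepends \<open>a\<close> as the lowest digit, so its
  value is \<open>a\<close> plus twice the value of \<open>\<delta>\<close>. The condition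
  \<open>a \<le> n\<close> keeps \<open>n - a\<close> from truncating.\<close>

lemma case_nat_mem_binary_reps_iff:
  "case_nat a \<delta> \<in> binary_reps A n \<longleftrightarrow>
     a \<in> A \<and> a \<le> n \<and> even (n - a) \<and> \<delta> \<in> binary_reps A ((n - a) div 2)"
proof (cases "finite {i. \<delta> i \<noteq> 0}")
  case True
  let ?s = "\<Sum>i | \<delta> i \<noteq> 0. \<delta> i * 2 ^ i"
  have "(\<Sum>i | case_nat a \<delta> i \<noteq> 0. case_nat a \<delta> i * 2 ^ i) = a + 2 * ?s"
    using sum_binary_digits_shift[of "case_nat a \<delta>"] True finite_support_case_nat_iff[of a \<delta>]
    by simp
  moreover have "a + 2 * ?s = n \<longleftrightarrow> a \<le> n \<and> even (n - a) \<and> ?s = (n - a) div 2"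
    by auto
  moreover have "(\<forall>i. case_nat a \<delta> i \<in> A) \<longleftrightarrow> a \<in> A \<and> (\<forall>i. \<delta> i \<in> A)"
    by (metis nat.case(1) nat.case(2) not0_implies_Suc)
  ultimately show ?thesis
    using True finite_support_case_nat_iff[of a \<delta>] by (auto simp: binary_reps_def)
next
  case False
  then show ?thesis
    using finite_support_case_nat_iff[of a \<delta>] by (auto simp: binary_reps_def)
qed

text \<open>A representation is a lowest digit together with a representation of the halved rest.
  This is the coefficientwise form of \<open>F = \<phi> F(x\<^sup>2)\<close>.\<close>

lemma num_reps_rec:
  "num_reps A n = (\<Sum>a | a \<in> A \<and> a \<le> n \<and> even (n - a). num_reps A ((n - a) div 2))"
proof -
  let ?D = "{a. a \<in> A \<and> a \<le> n \<and> even (n - a)}"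
  let ?P = "SIGMA a:?D. binary_reps A ((n - a) div 2)"
  let ?c = "\<lambda>(a, \<delta>). case_nat a \<delta> :: nat \<Rightarrow> nat"
  have inj: "inj_on ?c ?P"
  proof (rule inj_onI, clarify)
    fix a b :: nat and \<delta> \<epsilon> :: "nat \<Rightarrow> nat"
    assume eq: "case_nat a \<delta> = case_nat b \<epsilon>"
    show "a = b \<and> \<delta> = \<epsilon>"
      using fun_cong[OF eq, of 0] fun_cong[OF eq, of "Suc _"] by auto
  qed
  have image: "?c ` ?P = binary_reps A n"
  proof (intro equalityI subsetI)
    fix \<epsilon> assume "\<epsilon> \<in> ?c ` ?P"
    then show "\<epsilon> \<in> binary_reps A n" by (auto simp: case_nat_mem_binary_reps_iff)
  next
    fix \<epsilon> assume \<epsilon>: "\<epsilon> \<in> binary_reps A n"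
    have eq: "\<epsilon> = case_nat (\<epsilon> 0) (\<lambda>i. \<epsilon> (Suc i))"
      by (auto split: nat.splits)
    with \<epsilon> have "case_nat (\<epsilon> 0) (\<lambda>i. \<epsilon> (Suc i)) \<in> binary_reps A n" by simp
    then have "(\<epsilon> 0, \<lambda>i. \<epsilon> (Suc i)) \<in> ?P"
      unfolding case_nat_mem_binary_reps_iff by blast
    then show "\<epsilon> \<in> ?c ` ?P"
      using eq by (metis (no_types, lifting) image_eqI prod.case)
  qed
  have "num_reps A n = card ?P"
    unfolding num_reps_def image[symmetric] by (rule card_image[OF inj])
  also have "\<dots> = (\<Sum>a\<in>?D. num_reps A ((n - a) div 2))"
    unfolding num_reps_def
  proof (rule card_SigmaI)
    show "finite ?D" by (rule finite_subset[of _ "{..n}"]) auto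
  qed (simp add: finite_binary_reps)
  finally show ?thesis .
qed

lemma num_reps_0: "0 \<in> A \<Longrightarrow> num_reps A 0 = 1"
proof -
  assume "0 \<in> A"
  then have "binary_reps A 0 = {\<lambda>_. 0}"
    by (auto simp: binary_reps_def)
  then show ?thesis by (simp add: num_reps_def)
qed

section \<open>Power series over the field with two elements\<close>

lemma fps_bit_char2:
  fixes f g :: "bit fps"
  shows "f + f = 0" "f + (f + g) = g" "f - g = f + g" "- f = f"
proof -
  have "b + b = 0" for b :: bit by (cases b) auto
  then show d: "f + f = 0" for f :: "bit fps"
    by (intro fps_ext) (simp only: fps_add_nth fps_zero_nth)
  show "f + (f + g) = g" by (simp add: d flip: add.assoc)
  show "f - g = f + g" "- f = f" by (simp_all add: fps_eq_iff)
qed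

text \<open>Exchanging \<open>i\<close> and \<open>n - i\<close> pairs equal terms of the
  convolution, which cancel in characteristic 2. Only the middle term for even \<open>n\<close>
  survives, and there \<open>b * b = b\<close>. Hence squaring substitutes \<open>x\<^sup>2\<close>
  for \<open>x\<close>.\<close>

lemma fps_bit_square_nth:
  fixes f :: "bit fps"
  shows "(f\<^sup>2) $ n = (if even n then f $ (n div 2) else 0)"
proof -
  have sq: "b * b = b" for b :: bit by (cases b) auto
  let ?g = "\<lambda>i. f $ i * f $ (n - i)"
  let ?L = "{i. 2 * i < n}" and ?U = "{i. i \<le> n \<and> n < 2 * i}"
  have fin: "finite ?L" "finite ?U"
    by (auto intro: finite_subset[of _ "{..n}"])
  have "(\<Sum>i\<in>?U. ?g i) = (\<Sum>i\<in>?L. ?g i)"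
    by (rule sum.reindex_bij_witness[of _ "\<lambda>i. n - i" "\<lambda>i. n - i"]) (auto simp: mult.commute)
  moreover have "b + b = 0" for b :: bit by (cases b) auto
  ultimately have cancel: "(\<Sum>i\<in>?L \<union> ?U. ?g i) = 0"
    using fin by (subst sum.union_disjoint) auto
  have "(f\<^sup>2) $ n = (\<Sum>i\<in>{0..n}. ?g i)"
    by (simp add: power2_eq_square fps_mult_nth del: mult_bit_eq_and add_bit_eq_xor)
  also have "\<dots> = (if even n then f $ (n div 2) else 0)"
  proof (cases "even n")
    case True
    then have "{0..n} = insert (n div 2) (?L \<union> ?U)" by auto
    moreover have "n div 2 \<notin> ?L \<union> ?U" using True by auto
    moreover have "n - n div 2 = n div 2" using True by auto
    ultimately show ?thesis
      using True fin cancel sq by (simp del: mult_bit_eq_and add_bit_eq_xor)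
  next
    case False
    then have "{0..n} = ?L \<union> ?U" by (auto simp: not_less) presburger
    then show ?thesis
      using False cancel by simp
  qed
  finally show ?thesis .
qed

lemma num_reps_fps_inverse:
  fixes A :: "nat set"
  defines "F \<equiv> Abs_fps (\<lambda>n. of_nat (num_reps A n)) :: bit fps"
  assumes "finite A" "0 \<in> A"
  shows "(\<Sum>a\<in>A. fps_X ^ a) * F = 1"
proof -
  have "F = (\<Sum>a\<in>A. fps_X ^ a) * F\<^sup>2"
  proof (rule fps_ext)
    fix n
    have "F $ n = (\<Sum>a | a \<in> A \<and> a \<le> n \<and> even (n - a). F $ ((n - a) div 2))"
      unfolding F_def fps_nth_Abs_fps by (subst num_reps_rec) (rule of_nat_sum)
    also have "\<dots> = (\<Sum>a\<in>A. if a \<le> n \<and> even (n - a) then F $ ((n - a) div 2) else 0)"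
      using \<open>finite A\<close> by (subst sum.inter_filter[symmetric]) (auto intro: sum.cong)
    also have "\<dots> = ((\<Sum>a\<in>A. fps_X ^ a) * F\<^sup>2) $ n"
      unfolding sum_distrib_right fps_sum_nth fps_X_power_mult_nth fps_bit_square_nth
      by (rule sum.cong) auto
    finally show "F $ n = ((\<Sum>a\<in>A. fps_X ^ a) * F\<^sup>2) $ n" .
  qed
  then have "F * ((\<Sum>a\<in>A. fps_X ^ a) * F) = F * 1"
    by (simp add: power2_eq_square mult_ac)
  \<comment> \<open>The constant coefficient comes from the zero representation of 0; it makes
    \<open>F\<close> nonzero, so one factor \<open>F\<close> cancels.\<close>
  moreover have "F $ 0 = 1"
    using num_reps_0[OF \<open>0 \<in> A\<close>] by (simp add: F_def)
  then have "F \<noteq> 0" by auto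
  ultimately show ?thesis by (simp only: mult_cancel_left) simp
qed

section \<open>Odd entries of Pascal's triangle\<close>

lemma odd_binomial_le: "odd (n choose k) \<Longrightarrow> k \<le> n"
  by (rule ccontr) (simp add: not_le binomial_eq_0)

text \<open>Modulo 2 these are the coefficients of
  \<open>(1 + x) ^ (2 * n) = (1 + x\<^sup>2) ^ n\<close>. In the induction, Pascal's rule is applied
  twice to go from row \<open>2 * n\<close> to row \<open>2 * n + 2\<close>.\<close>

lemma binomial_parity_double:
  "even (2 * n choose Suc (2 * k))"
  "even (2 * n choose 2 * k) \<longleftrightarrow> even (n choose k)"
proof -
  have "(\<forall>k. even (2 * n choose Suc (2 * k))) \<and> (\<forall>k. even (2 * n choose 2 * k) \<longleftrightarrow> even (n choose k))"
  proof (induction n)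
    case 0
    have "even (0 choose 2 * k) \<longleftrightarrow> even (0 choose k)" for k
      by (cases k) auto
    then show ?case by simp
  next
    case (Suc n)
    then have IH: "even (2 * n choose Suc (2 * k))" "even (2 * n choose 2 * k) \<longleftrightarrow> even (n choose k)" for k
      by auto
    have "even (2 * Suc n choose Suc (2 * k))" for k
      using IH(1)[of k] IH(1)[of "k - 1"] by (cases k) auto
    moreover have "even (2 * Suc n choose 2 * k) \<longleftrightarrow> even (Suc n choose k)" for k
      using IH(1)[of "k - 1"] IH(2)[of k] IH(2)[of "k - 1"] by (cases k) auto
    ultimately show ?case by blast
  qed
  then show "even (2 * n choose Suc (2 * k))"
    "even (2 * n choose 2 * k) \<longleftrightarrow> even (n choose k)" by auto
qed

text \<open>One Pascal step from row \<open>2 * n\<close>, where the summand in an odd column is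
  even.\<close>

lemma binomial_parity_double_Suc:
  "even (Suc (2 * n) choose 2 * k) \<longleftrightarrow> even (n choose k)"
  "even (Suc (2 * n) choose Suc (2 * k)) \<longleftrightarrow> even (n choose k)"
proof -
  show "even (Suc (2 * n) choose 2 * k) \<longleftrightarrow> even (n choose k)"
    using binomial_parity_double(1)[of n "k - 1"] binomial_parity_double(2)[of n k]
    by (cases k) auto
  show "even (Suc (2 * n) choose Suc (2 * k)) \<longleftrightarrow> even (n choose k)"
    by (simp add: binomial_parity_double)
qed

text \<open>Row \<open>2 * m + 1\<close> repeats each parity of row \<open>m\<close> twice, so a row
  of odd entries stays odd as \<open>m\<close> runs through the numbers
  \<open>2 ^ r - 1\<close>.\<close>

lemma odd_binomial_mersenne: "Suc n = 2 ^ r \<Longrightarrow> k \<le> n \<Longrightarrow> odd (n choose k)"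
proof (induction r arbitrary: n k)
  case (Suc r)
  then have "odd n" by (metis even_Suc even_power even_numeral nat.distinct(1) dvd_triv_left power_Suc)
  then obtain m where m: "n = Suc (2 * m)" by (metis oddE Suc_eq_plus1)
  then have "Suc m = 2 ^ r" using Suc.prems by simp
  obtain j where "k = 2 * j \<or> k = Suc (2 * j)"
    by (metis oddE evenE Suc_eq_plus1)
  with Suc.IH[OF \<open>Suc m = 2 ^ r\<close>, of j] Suc.prems m show ?case
    by (auto simp: binomial_parity_double_Suc simp del: binomial_Suc_Suc)
qed simp

text \<open>Entries with \<open>k > a\<close> are 0, hence even, so each row contributes finitely
  many pairs.\<close>

definition odd_binomials :: "nat \<Rightarrow> (nat \<times> nat) set" where
  "odd_binomials m = {(a, k). a < m \<and> odd (a choose k)}"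

lemma odd_binomials_subset: "odd_binomials m \<subseteq> {..<m} \<times> {..<m}"
  unfolding odd_binomials_def by (auto dest: odd_binomial_le)

lemma finite_odd_binomials: "finite (odd_binomials m)"
  using odd_binomials_subset by (rule finite_subset) auto

text \<open>Sierpinski self-similarity: an odd entry \<open>(a, k)\<close> yields the odd entries
  \<open>(2a, 2k)\<close>, \<open>(2a+1, 2k)\<close> and \<open>(2a+1, 2k+1)\<close>, while
  \<open>(2a, 2k+1)\<close> is always even.\<close>

lemma card_odd_binomials_double: "card (odd_binomials (2 * m)) = 3 * card (odd_binomials m)"
proof -
  let ?B = "odd_binomials m"
  let ?f = "\<lambda>(a, k). (2 * a, 2 * k)"
  let ?g = "\<lambda>(a, k). (Suc (2 * a), 2 * k)"
  let ?h = "\<lambda>(a, k). (Suc (2 * a), Suc (2 * k))"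
  have split: "odd_binomials (2 * m) = ?f ` ?B \<union> (?g ` ?B \<union> ?h ` ?B)" (is "?L = ?R")
  proof (intro equalityI subsetI)
    fix p assume p: "p \<in> ?L"
    obtain a k where ak: "p = (2 * a, 2 * k) \<or> p = (2 * a, Suc (2 * k)) \<or>
        p = (Suc (2 * a), 2 * k) \<or> p = (Suc (2 * a), Suc (2 * k))"
      by (metis oddE evenE Suc_eq_plus1 surj_pair)
    then have "(a, k) \<in> ?B"
      using p unfolding odd_binomials_def
      by (auto simp: binomial_parity_double binomial_parity_double_Suc simp del: binomial_Suc_Suc)
    moreover have "p \<noteq> (2 * a, Suc (2 * k))"
      using p by (auto simp: odd_binomials_def binomial_parity_double simp del: binomial_Suc_Suc)
    ultimately show "p \<in> ?R" using ak by (auto simp: image_iff split: prod.splits)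
  next
    fix p assume "p \<in> ?R"
    then show "p \<in> ?L"
      unfolding odd_binomials_def
      by (auto simp: binomial_parity_double binomial_parity_double_Suc simp del: binomial_Suc_Suc)
  qed
  have "card (odd_binomials (2 * m)) = card (?f ` ?B) + (card (?g ` ?B) + card (?h ` ?B))"
  proof -
    have "?f ` ?B \<inter> (?g ` ?B \<union> ?h ` ?B) = {}" "?g ` ?B \<inter> ?h ` ?B = {}"
      by (auto simp: Suc_double_not_eq_double double_not_eq_Suc_double)
    then show ?thesis
      unfolding split by (simp add: card_Un_disjoint finite_odd_binomials)
  qed
  also have "\<dots> = card ?B + (card ?B + card ?B)"
  proof -
    have "inj_on ?f ?B" "inj_on ?g ?B" "inj_on ?h ?B"
      by (rule inj_onI, clarsimp)+
    then show ?thesis by (simp only: card_image)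
  qed
  finally show ?thesis by simp
qed

lemma card_odd_binomials: "card (odd_binomials (2 ^ r)) = 3 ^ r"
proof (induction r)
  case 0
  have "odd_binomials 1 = {(0, 0)}"
    unfolding odd_binomials_def by (auto dest: odd_binomial_le)
  then show ?case by simp
qed (simp add: card_odd_binomials_double)

text \<open>Row \<open>n\<close>, the last of the first \<open>2 ^ r\<close> rows, consists of
  \<open>Suc n\<close> odd entries and is removed from the count.\<close>

lemma card_odd_binomials_mersenne:
  assumes n: "Suc n = 2 ^ r"
  shows "card (odd_binomials n) + Suc n = 3 ^ r"
proof -
  have "odd_binomials (Suc n) = odd_binomials n \<union> {n} \<times> {..n}"
    using odd_binomial_mersenne[OF n]
    by (auto simp: odd_binomials_def less_Suc_eq dest: odd_binomial_le)
  also have "card \<dots> = card (odd_binomials n) + card ({n} \<times> {..n})"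
    by (rule card_Un_disjoint) (auto simp: finite_odd_binomials, auto simp: odd_binomials_def)
  finally show ?thesis using card_odd_binomials[of r] by (simp flip: n)
qed

section \<open>Periods and windows of consecutive terms\<close>

lemma is_period_mult:
  assumes "is_period s p"
  shows "s (n + k * p) = s n"
proof (induction k)
  case (Suc k)
  have "s (n + k * p + p) = s (n + k * p)" using assms by (simp add: is_period_def)
  then show ?case using Suc by (simp add: algebra_simps)
qed simp

text \<open>Shifting by the remainder of \<open>p\<close> modulo the least period also fixes the
  sequence; a positive remainder would be a smaller period.\<close>

lemma least_period_dvd:
  assumes "is_period s p"
  shows "least_period s dvd p"
proof -
  define L where "L = least_period s"
  have L: "is_period s L"
    unfolding L_def least_period_def using assms by (rule LeastI)
  have "s (n + p mod L) = s n" for n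
  proof -
    have "s (n + p mod L) = s (n + p mod L + p div L * L)" by (simp only: is_period_mult[OF L])
    also have "n + p mod L + p div L * L = n + p" by simp
    finally show ?thesis using assms by (simp add: is_period_def)
  qed
  moreover have "\<not> is_period s (p mod L)"
  proof
    assume "is_period s (p mod L)"
    then have "L \<le> p mod L" unfolding L_def least_period_def by (rule Least_le)
    moreover have "p mod L < L" using L by (simp add: is_period_def)
    ultimately show False by simp
  qed
  ultimately have "p mod L = 0" by (auto simp: is_period_def)
  then show ?thesis by (auto simp: L_def)
qed

text \<open>Reduction modulo \<open>N\<close> maps any \<open>N\<close> consecutive numbers
  bijectively onto \<open>{..<N}\<close>.\<close>

lemma card_window_mod:
  fixes N :: nat
  assumes "S \<subseteq> {..<N}"
  shows "card {n \<in> {m..<m + N}. n mod N \<in> S} = card S"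
proof -
  have inj: "inj_on (\<lambda>n. n mod N) {m..<m + N}"
  proof (rule linorder_inj_onI')
    fix i j assume ij: "i \<in> {m..<m + N}" "j \<in> {m..<m + N}" "i < j"
    show "i mod N \<noteq> j mod N"
    proof
      assume "i mod N = j mod N"
      then have "N dvd j - i" using ij by (metis mod_eq_dvd_iff_nat less_imp_le)
      then show False using ij by (auto dest: dvd_imp_le)
    qed
  qed
  have "(\<lambda>n. n mod N) ` {m..<m + N} = {..<N}"
    by (rule card_subset_eq) (auto simp: card_image[OF inj])
  moreover have "(\<lambda>n. n mod N) ` {n \<in> {m..<m + N}. n mod N \<in> S} = (\<lambda>n. n mod N) ` {m..<m + N} \<inter> S"
    by (auto simp del: mod_less)
  ultimately have "(\<lambda>n. n mod N) ` {n \<in> {m..<m + N}. n mod N \<in> S} = S"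
    using assms by (simp add: Int_absorb1)
  moreover have "inj_on (\<lambda>n. n mod N) {n \<in> {m..<m + N}. n mod N \<in> S}"
    using inj by (rule inj_on_subset) auto
  ultimately show ?thesis
    using card_image by fastforce
qed

section \<open>Powers of \<open>1 + y\<close> modulo 2 and the product \<open>u V\<close>\<close>

lemma bit_of_nat: "(of_nat n :: bit) = of_bool (odd n)"
  by (induction n) auto

lemma fps_bit_of_nat: "(of_nat n :: bit fps) = (if odd n then 1 else 0)"
proof -
  have "(of_nat (2 * k) :: bit fps) = 0" for k
    by (simp add: mult_2 fps_bit_char2)
  then show ?thesis by (auto elim!: evenE oddE simp del: of_nat_mult)
qed

lemma fps_bit_one_plus_power:
  fixes y :: "bit fps"
  shows "(1 + y) ^ a = (\<Sum>k | odd (a choose k). y ^ k)"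
proof -
  have "(1 + y) ^ a = (\<Sum>k\<le>a. of_nat (a choose k) * y ^ k)"
    using binomial_ring[of y 1 a] by (simp add: add.commute)
  also have "\<dots> = (\<Sum>k\<le>a. if odd (a choose k) then y ^ k else 0)"
    by (rule sum.cong) (auto simp: fps_bit_of_nat)
  also have "\<dots> = (\<Sum>k | k \<in> {..a} \<and> odd (a choose k). y ^ k)"
    by (rule sum.inter_filter[symmetric]) simp
  also have "{k. k \<in> {..a} \<and> odd (a choose k)} = {k. odd (a choose k)}"
    by (auto dest: odd_binomial_le)
  finally show ?thesis .
qed

text \<open>All entries of row \<open>n\<close> are odd. In \<open>quotient_identity\<close> this is
  where \<open>Suc n = 2 ^ r\<close> enters.\<close>

lemma fps_bit_one_plus_power_mersenne:
  fixes y :: "bit fps"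
  assumes "Suc n = 2 ^ r"
  shows "(1 + y) ^ n = (\<Sum>b\<le>n. y ^ b)"
proof -
  have "{k. odd (n choose k)} = {..n}"
    using odd_binomial_mersenne[OF assms] by (auto dest: odd_binomial_le)
  then show ?thesis by (simp add: fps_bit_one_plus_power)
qed

text \<open>For \<open>x = fps_X\<close> the first factor is \<open>x u\<close> and the right-hand side is \<open>x (1 + x ^ N)\<close>.\<close>

lemma quotient_identity:
  fixes x y :: "bit fps"
  assumes n: "Suc n = 2 ^ r" and y: "y = x ^ Suc n"
  shows "(x + y + x * y) *
           ((\<Sum>b<n. y ^ b) + (\<Sum>a<n. x ^ Suc a * y ^ (n - Suc a) * (1 + y) ^ a)) = x + y ^ Suc n"
proof -
  \<comment> \<open>With this \<open>z\<close> the first factor becomes \<open>z + y\<close>, and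
    \<open>A\<close> is the geometric quotient of \<open>z ^ n + y ^ n\<close> by it.\<close>
  define z where "z = x * (1 + y)"
  define A where "A = (\<Sum>a<n. y ^ (n - Suc a) * z ^ a)"
  define B where "B = (\<Sum>b<n. y ^ b)"
  have A: "(z + y) * A = z ^ n + y ^ n"
    using power_diff_sumr2[of z n y] by (simp add: A_def fps_bit_char2)
  have B: "(1 + y) * B = 1 + y ^ n"
    using one_diff_power_eq[of y n] by (simp add: B_def fps_bit_char2)
  \<comment> \<open>\<open>B\<close> lacks only the term \<open>y ^ n\<close> of the full sum
    \<open>(1 + y) ^ n\<close>.\<close>
  have B': "B = (1 + y) ^ n + y ^ n"
    using fps_bit_one_plus_power_mersenne[OF n, of y]
    by (simp add: B_def fps_bit_char2 add_ac flip: lessThan_Suc_atMost)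
  have z: "x * z ^ n = y * (1 + y) ^ n"
    by (simp add: z_def y power_mult_distrib mult_ac)
  have "(\<Sum>a<n. x ^ Suc a * y ^ (n - Suc a) * (1 + y) ^ a) = x * A"
    by (simp add: A_def z_def sum_distrib_left power_mult_distrib mult_ac)
  moreover have "x + y + x * y = z + y"
    by (simp add: z_def algebra_simps)
  moreover have "(z + y) * (B + x * A) = x * ((1 + y) * B) + y * B + x * ((z + y) * A)"
    by (simp add: z_def algebra_simps)
  \<comment> \<open>The terms \<open>x * y ^ n\<close> from \<open>A\<close> and \<open>B\<close>
    cancel, and \<open>x * z ^ n\<close> from \<open>A\<close> cancels
    \<open>y * (1 + y) ^ n\<close> from \<open>B'\<close>.\<close>
  moreover have "\<dots> = x + y ^ Suc n"
    unfolding A B unfolding B' distrib_left z by (simp add: fps_bit_char2 algebra_simps)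
  ultimately show ?thesis by (simp only: B_def)
qed

section \<open>The exponents of \<open>V\<close> and their number\<close>

text \<open>The pairs \<open>(c, b)\<close> such that \<open>x ^ c y ^ b\<close> occurs in \<open>V\<close>.\<close>

definition digit_pairs :: "nat \<Rightarrow> (nat \<times> nat) set" where
  "digit_pairs n = (\<lambda>b. (0, b)) ` {..<n} \<union> (\<lambda>(a, k). (Suc a, n - Suc a + k)) ` odd_binomials n"

lemma odd_binomials_le: "(a, k) \<in> odd_binomials n \<Longrightarrow> k \<le> a"
  by (simp add: odd_binomials_def odd_binomial_le)

text \<open>The bound on \<open>c\<close> makes it a base \<open>Suc n\<close> digit, so
  \<open>c + Suc n * b\<close> determines the pair; the bound on \<open>b\<close> keeps the shifted
  exponents below \<open>n * (n + 2)\<close>.\<close>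

lemma digit_pairs_subset: "digit_pairs n \<subseteq> {..n} \<times> {..<n}"
proof -
  have "Suc a \<le> n \<and> n - Suc a + k < n" if "(a, k) \<in> odd_binomials n" for a k
    using that odd_binomials_le[OF that] by (auto simp: odd_binomials_def)
  then show ?thesis by (fastforce simp: digit_pairs_def)
qed

lemma inj_on_odd_binomials_shift: "inj_on (\<lambda>(a, k). (Suc a, n - Suc a + k)) M"
  by (rule inj_onI) auto

text \<open>There are \<open>n\<close> pairs with first entry 0 and \<open>3 ^ r - Suc n\<close>
  with positive first entry.\<close>

lemma card_digit_pairs:
  assumes "Suc n = 2 ^ r"
  shows "card (digit_pairs n) = 3 ^ r - 1"
proof -
  have "card (digit_pairs n) = card ((\<lambda>b. (0::nat, b)) ` {..<n}) + card (odd_binomials n)"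
    unfolding digit_pairs_def
    by (subst card_Un_disjoint)
       (auto simp: finite_odd_binomials card_image[OF inj_on_odd_binomials_shift])
  also have "card ((\<lambda>b. (0::nat, b)) ` {..<n}) = n"
    by (subst card_image) (auto simp: inj_on_def)
  finally show ?thesis using card_odd_binomials_mersenne[OF assms] by linarith
qed

text \<open>Expanding \<open>(1 + y) ^ a\<close> modulo 2 turns each odd entry \<open>(a, k)\<close>
  into one monomial, and the entries are grouped by row.\<close>

lemma sum_digit_pairs:
  fixes x y :: "bit fps"
  shows "(\<Sum>(c, b)\<in>digit_pairs n. x ^ c * y ^ b) =
    (\<Sum>b<n. y ^ b) + (\<Sum>a<n. x ^ Suc a * y ^ (n - Suc a) * (1 + y) ^ a)"
proof -
  let ?h = "\<lambda>(c, b). x ^ c * y ^ b"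
  have "(\<Sum>p\<in>digit_pairs n. ?h p) = (\<Sum>p\<in>(\<lambda>b. (0, b)) ` {..<n}. ?h p)
      + (\<Sum>p\<in>(\<lambda>(a, k). (Suc a, n - Suc a + k)) ` odd_binomials n. ?h p)"
    unfolding digit_pairs_def
    by (rule sum.union_disjoint) (auto simp: finite_odd_binomials)
  also have "(\<Sum>p\<in>(\<lambda>b. (0, b)) ` {..<n}. ?h p) = (\<Sum>b<n. y ^ b)"
    by (subst sum.reindex) (auto simp: inj_on_def)
  also have "(\<Sum>p\<in>(\<lambda>(a, k). (Suc a, n - Suc a + k)) ` odd_binomials n. ?h p)
      = (\<Sum>(a, k)\<in>odd_binomials n. x ^ Suc a * y ^ (n - Suc a) * y ^ k)"
    by (subst sum.reindex[OF inj_on_odd_binomials_shift])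
       (auto intro!: sum.cong simp: power_add mult_ac)
  also have "odd_binomials n = (SIGMA a:{..<n}. {k. odd (a choose k)})"
    by (auto simp: odd_binomials_def)
  also have "(\<Sum>(a, k)\<in>(SIGMA a:{..<n}. {k. odd (a choose k)}). x ^ Suc a * y ^ (n - Suc a) * y ^ k)
      = (\<Sum>a<n. \<Sum>k | odd (a choose k). x ^ Suc a * y ^ (n - Suc a) * y ^ k)"
    by (rule sum.Sigma[symmetric])
       (auto intro!: finite_subset[OF _ finite_atMost] dest: odd_binomial_le)
  also have "\<dots> = (\<Sum>a<n. x ^ Suc a * y ^ (n - Suc a) * (1 + y) ^ a)"
    by (simp add: fps_bit_one_plus_power sum_distrib_left)
  finally show ?thesis .
qed

text \<open>The exponents of \<open>x ^ n V\<close> after substituting \<open>y = x ^ Suc n\<close>;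
  the shift by \<open>n\<close> is the numerator of \<open>x ^ n / u\<close>.\<close>

definition even_residues :: "nat \<Rightarrow> nat set" where
  "even_residues n = (\<lambda>(c, b). n + c + Suc n * b) ` digit_pairs n"

lemma inj_on_even_residues: "inj_on (\<lambda>(c, b). n + c + Suc n * b) (digit_pairs n)"
proof (rule inj_onI, clarify)
  fix c b c' b'
  assume "(c, b) \<in> digit_pairs n" "(c', b') \<in> digit_pairs n"
    and eq: "n + c + Suc n * b = n + c' + Suc n * b'"
  then have c: "c < Suc n" "c' < Suc n"
    using digit_pairs_subset[of n] by auto
  have eq: "c + Suc n * b = c' + Suc n * b'" using eq by linarith
  have "(c + Suc n * b) div Suc n = b" "(c' + Suc n * b') div Suc n = b'"
    using c by (simp_all del: mult_Suc)
  with eq have "b = b'" by metis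
  with eq show "c = c' \<and> b = b'" by simp
qed

lemma card_even_residues: "Suc n = 2 ^ r \<Longrightarrow> card (even_residues n) = 3 ^ r - 1"
  unfolding even_residues_def card_image[OF inj_on_even_residues] by (rule card_digit_pairs)

lemma even_residues_less: "even_residues n \<subseteq> {..<n * (n + 2)}"
proof -
  have "n + c + Suc n * b < n * (n + 2)" if "(c, b) \<in> digit_pairs n" for c b
  proof -
    have "c \<le> n" "Suc b \<le> n" using that digit_pairs_subset[of n] by auto
    then have "Suc n * Suc b \<le> Suc n * n" by (intro mult_le_mono2)
    with \<open>c \<le> n\<close> show ?thesis by (simp add: algebra_simps)
  qed
  then show ?thesis by (auto simp: even_residues_def)
qed

lemma even_residues_fps:
  assumes n: "Suc n = 2 ^ r"
  shows "(1 + fps_X ^ n + fps_X ^ Suc n) * (\<Sum>m\<in>even_residues n. fps_X ^ m)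
           = (fps_X ^ n * (1 + fps_X ^ (n * (n + 2))) :: bit fps)"
proof -
  let ?X = "fps_X :: bit fps"
  let ?y = "?X ^ Suc n"
  let ?V = "\<Sum>(c, b)\<in>digit_pairs n. ?X ^ c * ?y ^ b"
  have "(\<Sum>m\<in>even_residues n. ?X ^ m) = ?X ^ n * ?V"
    unfolding even_residues_def
    by (subst sum.reindex[OF inj_on_even_residues])
       (auto simp: sum_distrib_left power_add mult.assoc simp del: power_Suc mult_Suc
         simp flip: power_mult intro!: sum.cong)
  \<comment> \<open>\<open>quotient_identity\<close> carries an extra factor \<open>x\<close>, which
    is cancelled afterwards.\<close>
  moreover have "?X * ((1 + ?X ^ n + ?X ^ Suc n) * ?V) = ?X * (1 + ?X ^ (n * (n + 2)))"
  proof -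
    have "?X * ((1 + ?X ^ n + ?X ^ Suc n) * ?V) = (?X + ?y + ?X * ?y) * ?V"
      by (simp add: algebra_simps)
    also have "\<dots> = ?X + ?y ^ Suc n"
      unfolding sum_digit_pairs by (rule quotient_identity[OF n refl])
    \<comment> \<open>The exponent is \<open>(n + 1)\<^sup>2 = 1 + n * (n + 2)\<close>.\<close>
    also have "?y ^ Suc n = ?X * ?X ^ (n * (n + 2))"
      by (simp flip: power_mult power_Suc power_add add: algebra_simps)
    finally show ?thesis by (simp add: algebra_simps)
  qed
  then have "(1 + ?X ^ n + ?X ^ Suc n) * ?V = 1 + ?X ^ (n * (n + 2))"
    by (simp only: mult_cancel_left) simp
  ultimately show ?thesis by (simp only: mult.left_commute)
qed

section \<open>The positions of the even terms\<close>

text \<open>The equation says that coefficient \<open>n\<close> is the indicator of \<open>S\<close>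
  plus coefficient \<open>n - N\<close>, if \<open>n \<ge> N\<close>. As \<open>S\<close> lies below
  \<open>N\<close>, the two contributions never overlap.\<close>

lemma fps_periodic_support:
  fixes f :: "bit fps"
  assumes f: "(1 + fps_X ^ N) * f = (\<Sum>m\<in>S. fps_X ^ m)" and S: "S \<subseteq> {..<N}" and "N > 0"
  shows "f $ n = of_bool (n mod N \<in> S)"
proof (induction n rule: less_induct)
  case (less n)
  have "finite S" using S by (rule finite_subset) simp
  have "f + fps_X ^ N * f = (\<Sum>m\<in>S. fps_X ^ m)"
    using f by (simp add: algebra_simps)
  then have "f = (\<Sum>m\<in>S. fps_X ^ m) + fps_X ^ N * f"
    by (metis fps_bit_char2(2) add.commute)
  then have "f $ n = (\<Sum>m\<in>S. fps_X ^ m) $ n + (fps_X ^ N * f) $ n"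
    by (metis fps_add_nth)
  also have "(\<Sum>m\<in>S. fps_X ^ m) $ n = (of_bool (n \<in> S) :: bit)"
    using \<open>finite S\<close> by (simp add: fps_sum_nth)
  also have "(fps_X ^ N * f) $ n = (if n < N then 0 else f $ (n - N))"
    by (rule fps_X_power_mult_nth)
  finally show ?case
    using less[of "n - N"] S \<open>N > 0\<close> by (auto simp: le_mod_geq)
qed

text \<open>For \<open>r = 1\<close> the digits 1 and \<open>2 ^ r - 1\<close> would coincide. The
  function \<open>g\<close> is arbitrary so that both power series and \<open>digit_poly\<close> are
  covered.\<close>

lemma digit_set_elements_distinct:
  assumes "r \<ge> 2"
  shows "(\<Sum>a\<in>digit_set r. g a) = g 0 + g 1 + g (2 ^ r - 1) + g (2 ^ r + 1)"
proof -
  have "(2::nat) ^ 2 \<le> 2 ^ r" using assms by (intro power_increasing) auto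
  then have "0 \<noteq> (2::nat) ^ r - 1" "1 \<noteq> (2::nat) ^ r - 1" "2 ^ r - 1 \<noteq> (2::nat) ^ r + 1"
    by auto
  then show ?thesis by (simp add: digit_set_def add.assoc)
qed

lemma even_num_reps_digit_set_iff:
  assumes "r \<ge> 2"
  shows "even (num_reps (digit_set r) m) \<longleftrightarrow> m mod (4 ^ r - 1) \<in> even_residues (2 ^ r - 1)"
proof -
  define n where "n = (2::nat) ^ r - 1"
  have n: "Suc n = 2 ^ r" by (simp add: n_def)
  have "(4::nat) ^ r = Suc n * Suc n"
    unfolding n by (simp flip: power_mult_distrib)
  then have N: "4 ^ r - 1 = n * (n + 2)" by simp
  have "(2::nat) ^ 2 \<le> 2 ^ r" using assms by (intro power_increasing) auto
  then have "n > 0" by (simp add: n_def)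
  let ?X = "fps_X :: bit fps"
  define F where "F = (Abs_fps (\<lambda>m. of_nat (num_reps (digit_set r) m)) :: bit fps)"
  \<comment> \<open>\<open>G\<close> is \<open>1 / (1 + x)\<close>; adding it flips every
    coefficient, so \<open>F + G\<close> marks the even terms.\<close>
  define G where "G = (Abs_fps (\<lambda>_. 1) :: bit fps)"
  define u where "u = 1 + ?X ^ n + ?X ^ Suc n"
  \<comment> \<open>In the expanded product the two terms \<open>x ^ Suc n\<close> cancel.\<close>
  have "(\<Sum>a\<in>digit_set r. ?X ^ a) = (1 + ?X) * u"
    unfolding digit_set_elements_distinct[OF assms] u_def
    by (simp flip: n_def n add: algebra_simps fps_bit_char2)
  then have F: "(1 + ?X) * u * F = 1"
    using num_reps_fps_inverse[of "digit_set r"] by (simp add: F_def digit_set_def)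
  have "G = 1 + ?X * G"
    by (rule fps_ext) (simp add: G_def)
  then have G: "(1 + ?X) * G = 1"
    by (metis distrib_right fps_bit_char2(2) add.commute mult_1)
  have "(1 + ?X) * (u * (F + G)) = (1 + ?X) * u * F + u * ((1 + ?X) * G)"
    by (simp add: algebra_simps)
  \<comment> \<open>By \<open>F\<close> and \<open>G\<close> the sum is \<open>1 + u\<close>, that
    is \<open>x ^ n + x ^ Suc n\<close>.\<close>
  also have "\<dots> = (1 + ?X) * ?X ^ n"
    unfolding F G by (simp add: u_def algebra_simps fps_bit_char2)
  finally have E: "u * (F + G) = ?X ^ n"
    using G by (metis mult_cancel_left mult_zero_left zero_neq_one)
  have "u * ((1 + ?X ^ (n * (n + 2))) * (F + G)) = (u * (F + G)) * (1 + ?X ^ (n * (n + 2)))"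
    by (simp only: mult_ac)
  also have "\<dots> = u * (\<Sum>m\<in>even_residues n. ?X ^ m)"
    unfolding E unfolding u_def by (rule even_residues_fps[OF n, symmetric])
  moreover have "u \<noteq> 0"
  proof
    assume "u = 0"
    with F show False by simp
  qed
  ultimately have "(1 + ?X ^ (n * (n + 2))) * (F + G) = (\<Sum>m\<in>even_residues n. ?X ^ m)"
    by (simp only: mult_cancel_left) simp
  then have "(F + G) $ m = of_bool (m mod (n * (n + 2)) \<in> even_residues n)"
    by (rule fps_periodic_support) (use even_residues_less \<open>n > 0\<close> in auto)
  moreover have "(F + G) $ m = of_bool (even (num_reps (digit_set r) m))"
    by (simp add: F_def G_def bit_of_nat)
  ultimately show ?thesis
    unfolding N n_def[symmetric] by (metis of_bool_eq_iff)
qed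

theorem mainTheorem7:
  fixes r :: nat
  assumes "r \<ge> 3"
  shows "digit_poly (digit_set r)
           = 1 + monom 1 1 + monom 1 (2 ^ r - 1) + monom 1 (2 ^ r + 1)
       \<and> periodic (\<lambda>n. num_reps (digit_set r) n mod 2)
       \<and> least_period (\<lambda>n. num_reps (digit_set r) n mod 2) dvd 4 ^ r - 1
       \<and> (\<forall>m. card {n \<in> {m..<m + (4 ^ r - 1)}. odd (num_reps (digit_set r) n)} = 4 ^ r - 3 ^ r
            \<and> card {n \<in> {m..<m + (4 ^ r - 1)}. even (num_reps (digit_set r) n)} = 3 ^ r - 1)"
proof -
  define N where "N = (4::nat) ^ r - 1"
  have r: "r \<ge> 2" using assms by simp
  have "(4::nat) ^ 1 \<le> 4 ^ r" using assms by (intro power_increasing) auto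
  then have "N > 0" by (simp add: N_def)
  note ev = even_num_reps_digit_set_iff[OF r, folded N_def]
  have "num_reps (digit_set r) (n + N) mod 2 = num_reps (digit_set r) n mod 2" for n
    using ev[of n] ev[of "n + N"] by (simp add: mod2_eq_if)
  then have per: "is_period (\<lambda>n. num_reps (digit_set r) n mod 2) N"
    using \<open>N > 0\<close> by (simp add: is_period_def)
  have "(4::nat) ^ r = (2 ^ r) * (2 ^ r)"
    by (simp flip: power_mult_distrib)
  then have N: "N = (2 ^ r - 1) * ((2 ^ r - 1) + 2)"
    by (simp add: N_def algebra_simps)
  have even_card: "card {n \<in> {m..<m + N}. even (num_reps (digit_set r) n)} = 3 ^ r - 1" for m
    unfolding ev
    by (subst card_window_mod) (use even_residues_less[of "2 ^ r - 1"] in \<open>auto simp: N card_even_residues\<close>)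
  have odd_card: "card {n \<in> {m..<m + N}. odd (num_reps (digit_set r) n)} = 4 ^ r - 3 ^ r" for m
  proof -
    let ?O = "{n \<in> {m..<m + N}. odd (num_reps (digit_set r) n)}"
    let ?E = "{n \<in> {m..<m + N}. even (num_reps (digit_set r) n)}"
    have "{m..<m + N} = ?O \<union> ?E" by auto
    then have "card {m..<m + N} = card (?O \<union> ?E)" by (rule arg_cong)
    also have "\<dots> = card ?O + card ?E" by (rule card_Un_disjoint) auto
    finally have "N = card ?O + card ?E" by simp
    \<comment> \<open>The bound \<open>1 \<le> 3 ^ r\<close> keeps the truncated subtraction
      \<open>3 ^ r - 1\<close> exact.\<close>
    then show ?thesis
      using even_card[of m] N_def one_le_power[of "3::nat" r] by linarith
  qed
  have "digit_poly (digit_set r) = 1 + monom 1 1 + monom 1 (2 ^ r - 1) + monom 1 (2 ^ r + 1)"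
    unfolding digit_poly_def digit_set_elements_distinct[OF r] by (simp only: monom_eq_1)
  then show ?thesis
    using per least_period_dvd[OF per] even_card odd_card
    unfolding periodic_def N_def by blast
qed

end
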